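(* Let $\psi(k)\ge 0$, $k=1,2,\dots$, with $\sum_{k=1}^{\infty}k\psi(k)<\infty$, let $\beta\in\mathbb{R}$ and $n\in\mathbb{N}$. Then for every function $f\in C^{\psi}_{\beta}L_{1}$ $$\|f(\cdot)-S_{n-1}(f;\cdot)\|_{C}\le \frac1\pi\sum_{k=n}^{\infty}\psi(k)\,E_{n}(f^{\psi}_{\beta})_{L_{1}}.$$ Moreover, for every function $f\in C^{\psi}_{\beta}L_{1}$ there exists a function $\mathcal{F}(x)=\mathcal{F}(f;n,x)$ in $C^{\psi}_{\beta}L_{1}$ such that $E_{n}(\mathcal{F}^{\psi}_{\beta})_{L_{1}}=E_{n}(f^{\psi}_{\beta})_{L_{1}}$ and $$\|\mathcal{F}(\cdot)-S_{n-1}(\mathcal{F};\cdot)\|_{C}=\left(\frac1\pi\sum_{k=n}^{\infty}\psi(k)+\frac{\xi}{n}\sum_{k=1}^{\infty}k\psi(k+n)\right)E_{n}(f^{\psi}_{\beta})_{L_{1}},$$ where the quantity $\xi=\xi(f;n;\psi;\beta)$ satisfies $-2\le\xi\le 0$.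
   Context: All functions are real-valued and $2\pi$-periodic; $\mathbb{N}=\{1,2,\dots\}$. $L_1$ is the space of $2\pi$-periodic functions summable on $[0,2\pi)$ with norm $\|f\|_1=\int_0^{2\pi}|f(t)|\,dt$; $C$ is the space of continuous $2\pi$-periodic functions with norm $\|f\|_C=\max_t|f(t)|$. For a sequence $\psi(k)\ge0$ with $\sum_{k=1}^\infty\psi(k)<\infty$ and $\beta\in\mathbb{R}$, put $\Psi_\beta(t)=\sum_{k=1}^{\infty}\psi(k)\cos\left(kt-\frac{\beta\pi}{2}\right)$. $C^{\psi}_{\beta}L_1$ is the set of $2\pi$-periodic functions $f$ which for all $x\in\mathbb{R}$ have the form $$f(x)=\frac{a_0}{2}+\frac1\pi\int_{-\pi}^{\pi}\Psi_\beta(x-t)\varphi(t)\,dt,\qquad a_0\in\mathbb{R},\ \varphi\in L_1,\ \int_{-\pi}^{\pi}\varphi(t)\,dt=0.$$ The function $\varphi$ in this representation is called the $(\psi,\beta)$-derivative of $f$ and is denoted $f^{\psi}_{\beta}$. $S_{n-1}(f;\cdot)$ is the partial Fourier sum of $f$ of order $n-1$. For $g\in L_1$, $E_n(g)_{L_1}=\inf\|g-t_{n-1}\|_1$, the infimum being over all trigonometric polynomials $t_{n-1}$ of order at most $n-1$.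
   Formalization: The second part assumes also that if ψ(n)>0 then ψ(k)>0 for some k>n; without this it is false, e.g. n=1, ψ(1)=1, ψ(k)=0 for k≥2, β=0, f=cos. Where derivatives are not unique, it holds for every derivative of f and some derivative of F. *)

theory Defs
  imports "HOL-Analysis.Analysis" "HOL-Library.Periodic_Fun"
begin

definition periodic_2pi :: "(real \<Rightarrow> real) \<Rightarrow> bool" where
  "periodic_2pi f \<longleftrightarrow> (\<forall>t. f (t + 2 * pi) = f t)"

text \<open>The elements of the spaces are functions, not classes modulo equality almost everywhere.\<close>

definition space_L1 :: "(real \<Rightarrow> real) set" where
  "space_L1 = {g. periodic_2pi g \<and> g absolutely_integrable_on {0..2 * pi}}"

definition norm_L1 :: "(real \<Rightarrow> real) \<Rightarrow> real" where
  "norm_L1 g = (LINT t:{0..2 * pi}|lebesgue. \<bar>g t\<bar>)"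

definition space_C :: "(real \<Rightarrow> real) set" where
  "space_C = {f. periodic_2pi f \<and> continuous_on UNIV f}"

text \<open>Meaningful only on \<^const>\<open>space_C\<close>, where the supremum is a maximum
  (lemma \<open>norm_C_attained\<close>).\<close>

definition norm_C :: "(real \<Rightarrow> real) \<Rightarrow> real" where
  "norm_C f = (SUP t. \<bar>f t\<bar>)"

lemma norm_C_attained:
  assumes "f \<in> space_C"
  obtains t where "norm_C f = \<bar>f t\<bar>" and "\<And>s. \<bar>f s\<bar> \<le> \<bar>f t\<bar>"
proof -
  have per: "\<And>t. f (t + 2 * pi) = f t" and cont: "continuous_on UNIV f"
    using assms by (auto simp: space_C_def periodic_2pi_def)
  interpret periodic_fun_simple f "2 * pi"
    by standard (rule per)
  have "continuous_on {0..2 * pi} (\<lambda>t. \<bar>f t\<bar>)"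
    by (intro continuous_intros continuous_on_subset[OF cont]) auto
  then obtain t where t: "\<And>s. s \<in> {0..2 * pi} \<Longrightarrow> \<bar>f s\<bar> \<le> \<bar>f t\<bar>"
    using continuous_attains_sup[of "{0..2 * pi}" "\<lambda>t. \<bar>f t\<bar>"]
    by (metis atLeastAtMost_iff compact_Icc empty_iff order_refl pi_ge_zero mult_nonneg_nonneg zero_le_numeral)
  have le: "\<bar>f s\<bar> \<le> \<bar>f t\<bar>" for s
  proof -
    define m where "m = \<lfloor>s / (2 * pi)\<rfloor>"
    have "of_int m \<le> s / (2 * pi)" "s / (2 * pi) < of_int m + 1"
      unfolding m_def by linarith+
    hence "s - of_int m * (2 * pi) \<in> {0..2 * pi}"
      by (simp add: field_simps)
    from t[OF this] show ?thesis
      by (simp add: minus_of_int)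
  qed
  have "norm_C f = \<bar>f t\<bar>"
    unfolding norm_C_def by (rule cSup_eq_maximum) (use le in auto)
  with le show ?thesis by (rule that[rotated])
qed

definition trig_polys :: "nat \<Rightarrow> (real \<Rightarrow> real) set" where
  "trig_polys m = {p. \<exists>a b :: nat \<Rightarrow> real.
     p = (\<lambda>x. a 0 / 2 + (\<Sum>k=1..m. a k * cos (real k * x) + b k * sin (real k * x)))}"

definition fourier_cos :: "(real \<Rightarrow> real) \<Rightarrow> nat \<Rightarrow> real" where
  "fourier_cos f k = 1 / pi * (LINT t:{-pi..pi}|lebesgue. f t * cos (real k * t))"

definition fourier_sin :: "(real \<Rightarrow> real) \<Rightarrow> nat \<Rightarrow> real" where
  "fourier_sin f k = 1 / pi * (LINT t:{-pi..pi}|lebesgue. f t * sin (real k * t))"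

definition fourier_sum :: "nat \<Rightarrow> (real \<Rightarrow> real) \<Rightarrow> real \<Rightarrow> real" where
  "fourier_sum m f x = fourier_cos f 0 / 2 +
     (\<Sum>k=1..m. fourier_cos f k * cos (real k * x) + fourier_sin f k * sin (real k * x))"

text \<open>As usual, \<open>E\<^sub>n\<close> refers to polynomials of order at most \<open>n - 1\<close>; it is used for \<open>n \<ge> 1\<close> only.\<close>

definition best_approx_L1 :: "nat \<Rightarrow> (real \<Rightarrow> real) \<Rightarrow> real" where
  "best_approx_L1 n g = (INF p\<in>trig_polys (n - 1). norm_L1 (\<lambda>t. g t - p t))"

text \<open>Sequences are indexed from 1, so the value \<open>\<psi> 0\<close> is never used.\<close>

definition Psi_kernel :: "(nat \<Rightarrow> real) \<Rightarrow> real \<Rightarrow> real \<Rightarrow> real" where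
  "Psi_kernel \<psi> \<beta> t = (\<Sum>k. \<psi> (Suc k) * cos (real (Suc k) * t - \<beta> * pi / 2))"

text \<open>A relation, not a function: \<open>\<phi>\<close> is determined only up to null sets, and where
  \<open>\<psi> k = 0\<close> its \<open>k\<close>-th Fourier coefficients are not determined by \<open>f\<close>.\<close>

definition is_psi_beta_deriv ::
  "(nat \<Rightarrow> real) \<Rightarrow> real \<Rightarrow> (real \<Rightarrow> real) \<Rightarrow> (real \<Rightarrow> real) \<Rightarrow> bool" where
  "is_psi_beta_deriv \<psi> \<beta> f \<phi> \<longleftrightarrow>
     \<phi> \<in> space_L1 \<and> (LINT t:{-pi..pi}|lebesgue. \<phi> t) = 0 \<and>
     (\<exists>a0. \<forall>x. f x = a0 / 2 +
        1 / pi * (LINT t:{-pi..pi}|lebesgue. Psi_kernel \<psi> \<beta> (x - t) * \<phi> t))"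

definition class_C_psi_beta_L1 :: "(nat \<Rightarrow> real) \<Rightarrow> real \<Rightarrow> (real \<Rightarrow> real) set" where
  "class_C_psi_beta_L1 \<psi> \<beta> = {f. periodic_2pi f \<and> (\<exists>\<phi>. is_psi_beta_deriv \<psi> \<beta> f \<phi>)}"

end

theory Submission
  imports Defs
begin

text \<open>A function \<open>f\<close> with \<open>(\<psi>,\<beta>)\<close>-derivative \<open>\<phi>\<close> has the Fourier series with terms
\<open>\<psi>(k) H\<^sub>k(x)\<close>, where \<open>H\<^sub>k(x) = 1/\<pi> \<integral> cos (k (x - t) - \<beta>\<pi>/2) \<phi>(t) dt\<close>. It converges uniformly, so
the remainder \<open>f - S\<^sub>n\<^sub>-\<^sub>1 f\<close> is its tail \<open>\<Sum>\<^sub>k\<^sub>\<ge>\<^sub>n \<psi>(k) H\<^sub>k\<close> (lemma \<open>remainder_expansion\<close>). For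
\<open>k \<ge> n\<close> the integral defining \<open>H\<^sub>k\<close> does not change when a polynomial of order \<open>n - 1\<close> is subtracted
from \<open>\<phi>\<close>, and the cosine is at most 1; this gives the upper bound (lemma \<open>remainder_le\<close>).

The upper bound holds for all functions of the class, so the second part amounts to a lower bound:
with \<open>E\<close> the best approximation of \<open>\<phi>\<close>, \<open>S = \<Sum>\<^sub>k\<^sub>\<ge>\<^sub>n \<psi>(k)\<close> and \<open>W = \<Sum>\<^sub>k\<^sub>\<ge>\<^sub>1 k \<psi>(k + n)\<close>, some
derivative \<open>\<Phi>\<close> with best approximation \<open>E\<close> must produce a remainder of norm at least
\<open>(S/\<pi> - 2W/n) E\<close>; then \<open>\<xi>\<close> is obtained by solving the equation. Equality in the upper bound
at a point \<open>x\<close> would require all the cosines with \<open>k \<ge> n\<close> to equal, up to a common factor \<open>\<plusminus>1\<close>,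
the sign of \<open>\<Phi>\<close> on the support of \<open>\<Phi>\<close>. For \<open>x = 0\<close> and \<open>k = n\<close> this can be had at two
neighbouring extrema of the cosine, both within \<open>\<pi>/n\<close> of 0. Take
for \<open>\<Phi>\<close> a narrow positive bump at one and a negative one at the other. For larger \<open>k\<close>
the phases of the cosines at the two points differ from the ideal ones by at most \<open>(k - n) \<pi>/n\<close>, and
\<open>cos z \<ge> 1 - \<bar>z\<bar>\<close> bounds the total loss by \<open>\<pi> W/n\<close> plus a term proportional to the width of the
bumps. The mean of \<open>\<Phi>\<close> is zero because the two masses cancel, and its best approximation equals its
norm because the sign of \<open>\<Phi>\<close> extends to a function that changes sign under the shift by \<open>\<pi>/n\<close>, and
such functions annihilate all polynomials of order \<open>n - 1\<close> (lemmas \<open>antiperiodic_orthogonal\<close> and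
\<open>alternating_bumps\<close>).\<close>

section \<open>Integrals of periodic functions over a period\<close>

text \<open>The interval \<open>[a, a + T]\<close> is cut by a multiple of \<open>T\<close>; moving the piece
behind that point back by \<open>T\<close> fills the cell of \<open>\<int>T\<close> that contains \<open>a\<close>.\<close>

lemma periodic_integral_shift:
  fixes g :: "real \<Rightarrow> real"
  assumes per: "\<And>t. g (t + T) = g t" and T: "T > 0" and int: "g integrable_on {0..T}"
  shows "g integrable_on {a..a + T}" and "integral {a..a + T} g = integral {0..T} g"
proof -
  interpret periodic_fun_simple g T by standard (rule per)
  define j where "j = \<lfloor>a / T\<rfloor>"
  have j: "of_int j * T \<le> a" "a \<le> of_int (j + 1) * T"
    using T floor_correct[of "a / T"] unfolding j_def
    by (simp_all add: pos_le_divide_eq[symmetric] pos_divide_le_eq[symmetric] less_imp_le)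
  have cell: "(g has_integral integral {0..T} g) {of_int i * T..of_int (i + 1) * T}" for i
  proof -
    have "(\<lambda>x. g (x + of_int i * T)) = g" by (simp add: plus_of_int)
    with has_integral_shift_real_ivl_iff[of g "integral {0..T} g" "of_int i * T" "of_int (i + 1) * T" "of_int i * T"]
    show ?thesis using integrable_integral[OF int] by (simp add: algebra_simps)
  qed
  have cell': "(g has_integral integral {0..T} g) {of_int (j + 1) * T..of_int (j + 2) * T}"
    using cell[of "j + 1"] by (simp add: algebra_simps)
  have whole: "g integrable_on {of_int j * T..of_int (j + 2) * T}"
    by (rule Henstock_Kurzweil_Integration.integrable_combine[OF _ _ has_integral_integrable[OF cell] has_integral_integrable[OF cell']])
       (use T in auto)
  have a2: "a + T \<le> of_int (j + 2) * T" "of_int (j + 1) * T \<le> a + T"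
    using j T by (auto simp: algebra_simps)
  have big: "g integrable_on {u..v}" if "of_int j * T \<le> u" "v \<le> a + T" for u v
    by (rule integrable_subinterval_real[OF whole]) (use that a2 in auto)
  show "g integrable_on {a..a + T}"
    by (rule big) (use j in auto)
  have "integral {of_int (j + 1) * T..a + T} g = integral {of_int j * T..a} g"
    using integral_shift_real_ivl[of "of_int (j + 1) * T" T "a + T" g]
    by (simp add: per algebra_simps)
  moreover have "integral {of_int j * T..a} g + integral {a..of_int (j + 1) * T} g = integral {0..T} g"
    using Henstock_Kurzweil_Integration.integral_combine[of "of_int j * T" a "of_int (j + 1) * T" g] big j integral_unique[OF cell[of j]] a2
    by simp
  moreover have "integral {a..of_int (j + 1) * T} g + integral {of_int (j + 1) * T..a + T} g
      = integral {a..a + T} g"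
    using Henstock_Kurzweil_Integration.integral_combine[of a "of_int (j + 1) * T" "a + T" g] big j a2 by simp
  ultimately show "integral {a..a + T} g = integral {0..T} g" by simp
qed

text \<open>The norm is taken over \<open>[0, 2\<pi>]\<close>, the convolutions and Fourier coefficients over
\<open>[-\<pi>, \<pi>]\<close>; on \<^const>\<open>space_L1\<close> the two agree, and one functional serves for both.\<close>

definition period_int :: "(real \<Rightarrow> real) \<Rightarrow> real" where
  "period_int g = (LINT t:{-pi..pi}|lebesgue. g t)"

lemma space_L1_absolutely_integrable:
  assumes "g \<in> space_L1"
  shows "g absolutely_integrable_on {a..a + 2 * pi}"
    and "(LINT t:{a..a + 2 * pi}|lebesgue. g t) = integral {0..2 * pi} g"
proof -
  have per: "\<And>t. g (t + 2 * pi) = g t" and int: "g absolutely_integrable_on {0..2 * pi}"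
    using assms by (auto simp: space_L1_def periodic_2pi_def)
  from int show A: "g absolutely_integrable_on {a..a + 2 * pi}"
    unfolding absolutely_integrable_on_def
    using periodic_integral_shift(1)[of g "2 * pi" a] 
      periodic_integral_shift(1)[of "\<lambda>t. \<bar>g t\<bar>" "2 * pi" a] per by auto
  show "(LINT t:{a..a + 2 * pi}|lebesgue. g t) = integral {0..2 * pi} g"
    using periodic_integral_shift(2)[of g "2 * pi" a] per int
    by (simp add: set_lebesgue_integral_eq_integral(2)[OF A] absolutely_integrable_on_def)
qed

lemma space_L1_integrable:
  "g \<in> space_L1 \<Longrightarrow> set_integrable lebesgue {-pi..pi} g"
  using space_L1_absolutely_integrable(1)[of g "-pi"] by simp

lemma period_int_eq: "g \<in> space_L1 \<Longrightarrow> period_int g = integral {0..2 * pi} g"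
  using space_L1_absolutely_integrable(2)[of g "-pi"] by (simp add: period_int_def)

lemma space_L1_abs: "g \<in> space_L1 \<Longrightarrow> (\<lambda>t. \<bar>g t\<bar>) \<in> space_L1"
  by (auto simp: space_L1_def periodic_2pi_def set_integrable_abs)

lemma norm_L1_eq_period_int: "g \<in> space_L1 \<Longrightarrow> norm_L1 g = period_int (\<lambda>t. \<bar>g t\<bar>)"
  using space_L1_absolutely_integrable(2)[OF space_L1_abs, of g 0] period_int_eq[OF space_L1_abs]
  by (simp add: norm_L1_def)

lemma period_int_shift:
  assumes "g \<in> space_L1"
  shows "(\<lambda>t. g (t + s)) \<in> space_L1" and "period_int (\<lambda>t. g (t + s)) = period_int g"
proof -
  have per: "g (t + s + 2 * pi) = g (t + s)" for t
    using assms by (auto simp: space_L1_def periodic_2pi_def)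
  have abs: "g absolutely_integrable_on {s..s + 2 * pi}"
    by (rule space_L1_absolutely_integrable(1)[OF assms])
  hence "g integrable_on {s..s + 2 * pi}" "(\<lambda>t. \<bar>g t\<bar>) integrable_on {s..s + 2 * pi}"
    by (auto simp: absolutely_integrable_on_def)
  hence "(\<lambda>t. g (t + s)) integrable_on {0..2 * pi}" "(\<lambda>t. \<bar>g (t + s)\<bar>) integrable_on {0..2 * pi}"
    using integrable_shift_real_ivl[of g s "s + 2 * pi" s]
      integrable_shift_real_ivl[of "\<lambda>t. \<bar>g t\<bar>" s "s + 2 * pi" s] by simp_all
  thus *: "(\<lambda>t. g (t + s)) \<in> space_L1"
    using per by (auto simp: space_L1_def periodic_2pi_def absolutely_integrable_on_def algebra_simps)
  have "period_int (\<lambda>t. g (t + s)) = integral {s..s + 2 * pi} g"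
    using integral_shift_real_ivl[of s s "s + 2 * pi" g] by (simp add: period_int_eq[OF *])
  also have "\<dots> = period_int g"
    using space_L1_absolutely_integrable(2)[OF assms, of s] set_lebesgue_integral_eq_integral(2)[OF abs]
    by (simp add: period_int_eq[OF assms])
  finally show "period_int (\<lambda>t. g (t + s)) = period_int g" .
qed

lemma space_L1_add: "f \<in> space_L1 \<Longrightarrow> g \<in> space_L1 \<Longrightarrow> (\<lambda>t. f t + g t) \<in> space_L1"
  and space_L1_diff: "f \<in> space_L1 \<Longrightarrow> g \<in> space_L1 \<Longrightarrow> (\<lambda>t. f t - g t) \<in> space_L1"
  and space_L1_cmult: "f \<in> space_L1 \<Longrightarrow> (\<lambda>t. c * f t) \<in> space_L1"
  by (auto simp: space_L1_def periodic_2pi_def set_integral_add set_integral_diff set_integrable_mult_right)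

lemma space_C_imp_space_L1: "g \<in> space_C \<Longrightarrow> g \<in> space_L1"
  by (auto simp: space_L1_def space_C_def intro!: absolutely_integrable_continuous_real
      intro: continuous_on_subset)

lemma space_L1_bounded_mult:
  assumes g: "g \<in> space_L1" and h: "h \<in> borel_measurable borel" "periodic_2pi h" "\<And>t. \<bar>h t\<bar> \<le> B"
  shows "(\<lambda>t. h t * g t) \<in> space_L1"
proof -
  have "h \<in> borel_measurable (lebesgue_on {0..2 * pi})"
    using h(1) borel_measurable_subalgebra by (simp add: measurable_restrict_space1 measurable_completion)
  moreover have "bounded (h ` {0..2 * pi})"
    using h(3) by (auto simp: bounded_iff)
  ultimately show ?thesis
    using g h(2) absolutely_integrable_bounded_measurable_product_real[of h "{0..2 * pi}" g]
    by (auto simp: space_L1_def periodic_2pi_def)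
qed

lemma period_int_add: "f \<in> space_L1 \<Longrightarrow> g \<in> space_L1 \<Longrightarrow>
    period_int (\<lambda>t. f t + g t) = period_int f + period_int g"
  and period_int_diff: "f \<in> space_L1 \<Longrightarrow> g \<in> space_L1 \<Longrightarrow>
    period_int (\<lambda>t. f t - g t) = period_int f - period_int g"
  and period_int_mono: "f \<in> space_L1 \<Longrightarrow> g \<in> space_L1 \<Longrightarrow> (\<And>t. f t \<le> g t) \<Longrightarrow>
    period_int f \<le> period_int g"
  unfolding period_int_def
  by (auto simp: space_L1_integrable intro: set_integral_add set_integral_diff set_integral_mono)

lemma period_int_cmult: "period_int (\<lambda>t. c * f t) = c * period_int f"
  by (simp add: period_int_def)

lemma period_int_abs_bound:
  assumes "g \<in> space_L1" shows "\<bar>period_int g\<bar> \<le> norm_L1 g"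
  using period_int_mono[OF assms space_L1_abs[OF assms]] assms
    period_int_mono[OF space_L1_cmult[OF assms, of "-1"] space_L1_abs[OF assms]]
    period_int_cmult[of "-1" g]
  by (simp add: norm_L1_eq_period_int abs_le_iff)

text \<open>The only interchange of sum and integral. It is applied with \<open>g\<close> the derivative, to expand
the convolution, and with \<open>g\<close> a cosine, to compute the Fourier coefficients of that expansion.\<close>

lemma period_int_suminf:
  assumes g: "g \<in> space_L1" and w: "\<And>k. w k \<in> space_C" and bd: "\<And>k t. \<bar>w k t\<bar> \<le> M k"
    and sm: "summable M"
  shows "(\<lambda>k. period_int (\<lambda>t. w k t * g t)) sums period_int (\<lambda>t. (\<Sum>k. w k t) * g t)"
proof -
  have wg: "(\<lambda>t. w k t * g t) \<in> space_L1" for k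
    using g w[of k] bd[of k] unfolding space_C_def
    by (intro space_L1_bounded_mult[where B = "M k"] borel_measurable_continuous_onI) auto
  have sw: "summable (\<lambda>k. w k t)" for t
    using bd by (intro summable_comparison_test'[OF sm, of 0]) simp
  let ?F = "\<lambda>k t. indicator {-pi..pi} t *\<^sub>R (w k t * g t)"
  have "(\<lambda>k. integral\<^sup>L lebesgue (?F k)) sums (\<integral>t. (\<Sum>k. ?F k t) \<partial>lebesgue)"
  proof (rule sums_integral)
    show "integrable lebesgue (?F k)" for k
      using space_L1_integrable[OF wg[of k]] by (simp add: set_integrable_def)
    show "AE t in lebesgue. summable (\<lambda>k. norm (?F k t))"
    proof (rule AE_I2)
      fix t
      have "summable (\<lambda>k. M k * \<bar>g t\<bar>)" using sm by (rule summable_mult2)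
      thus "summable (\<lambda>k. norm (?F k t))"
        by (rule summable_comparison_test'[where N = 0])
           (use order_trans[OF abs_ge_zero bd] in
             \<open>auto simp: abs_mult indicator_def bd mult_right_mono\<close>)
    qed
    show "summable (\<lambda>k. \<integral>t. norm (?F k t) \<partial>lebesgue)"
    proof (rule summable_comparison_test'[where N = 0])
      show "summable (\<lambda>k. M k * norm_L1 g)" using sm by (rule summable_mult2)
      fix k
      have "(\<integral>t. norm (?F k t) \<partial>lebesgue) = period_int (\<lambda>t. \<bar>w k t * g t\<bar>)"
        by (simp add: period_int_def set_lebesgue_integral_def abs_mult)
      moreover have "\<dots> \<le> period_int (\<lambda>t. M k * \<bar>g t\<bar>)"
        by (intro period_int_mono space_L1_abs wg space_L1_cmult g)
           (simp add: abs_mult bd mult_right_mono)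
      moreover have "\<dots> = M k * norm_L1 g"
        by (simp add: period_int_cmult norm_L1_eq_period_int g)
      moreover have "0 \<le> (\<integral>t. norm (?F k t) \<partial>lebesgue)" by simp
      ultimately show "norm (\<integral>t. norm (?F k t) \<partial>lebesgue) \<le> M k * norm_L1 g" by simp
    qed
  qed
  moreover have "(\<Sum>k. ?F k t) = indicator {-pi..pi} t *\<^sub>R ((\<Sum>k. w k t) * g t)" for t
    using suminf_mult[OF summable_mult2[OF sw[of t], of "g t"]] suminf_mult2[OF sw[of t]] by simp
  ultimately show ?thesis
    by (simp add: period_int_def set_lebesgue_integral_def)
qed

section \<open>Harmonics of a summable function\<close>

lemma space_C_add: "f \<in> space_C \<Longrightarrow> g \<in> space_C \<Longrightarrow> (\<lambda>t. f t + g t) \<in> space_C"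
  and space_C_cmult: "f \<in> space_C \<Longrightarrow> (\<lambda>t. c * f t) \<in> space_C"
  and space_C_const: "(\<lambda>t. c) \<in> space_C"
  by (auto simp: space_C_def periodic_2pi_def intro!: continuous_intros)

lemma space_C_cos: "(\<lambda>t. cos (of_int m * t + c)) \<in> space_C"
proof -
  have "cos (of_int m * (t + 2 * pi) + c) = cos (of_int m * t + c)" for t
    using cos.plus_of_int[of "of_int m * t + c" m] by (simp add: algebra_simps)
  thus ?thesis
    by (auto simp: space_C_def periodic_2pi_def intro!: continuous_intros)
qed

lemma space_C_kernel: "(\<lambda>t. cos (real k * (x - t) - c)) \<in> space_C"
  using space_C_cos[of "- int k" "real k * x - c"] by (simp add: algebra_simps)

lemma space_C_cos_nat: "(\<lambda>t. cos (real k * t + c)) \<in> space_C"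
  using space_C_cos[of "int k" c] by simp

lemma space_L1_mult_space_C:
  assumes "g \<in> space_L1" and "w \<in> space_C" shows "(\<lambda>t. w t * g t) \<in> space_L1"
proof -
  have "\<bar>w t\<bar> \<le> norm_C w" for t using norm_C_attained[OF assms(2)] by metis
  thus ?thesis
    using assms by (intro space_L1_bounded_mult[where B = "norm_C w"] borel_measurable_continuous_onI)
      (auto simp: space_C_def)
qed

lemma space_C_suminf:
  assumes w: "\<And>k. w k \<in> space_C" and bd: "\<And>k t. \<bar>w k t\<bar> \<le> M k" and sm: "summable M"
  shows "(\<lambda>t. \<Sum>k. w k t) \<in> space_C"
proof -
  have "uniform_limit UNIV (\<lambda>n t. \<Sum>k<n. w k t) (\<lambda>t. \<Sum>k. w k t) sequentially"
    by (rule Weierstrass_m_test[OF _ sm]) (use bd in auto)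
  hence "continuous_on UNIV (\<lambda>t. \<Sum>k. w k t)"
    by (rule uniform_limit_theorem[rotated])
       (use w in \<open>auto simp: space_C_def intro!: always_eventually continuous_on_sum\<close>)
  thus ?thesis using w by (simp add: space_C_def periodic_2pi_def)
qed

lemma period_int_const: "period_int (\<lambda>t. c) = 2 * pi * c"
  by (simp add: period_int_def set_lebesgue_integral_def)

text \<open>A shift by half a wavelength \<open>\<pi>/m\<close> preserves the integral and changes its sign.\<close>

lemma period_int_cos:
  assumes "m \<noteq> 0" shows "period_int (\<lambda>t. cos (of_int m * t + c)) = 0"
proof -
  have "cos (of_int m * (t + pi / of_int m) + c) = - 1 * cos (of_int m * t + c)" for t
    using assms cos_periodic_pi[of "of_int m * t + c"] by (simp add: algebra_simps)
  with period_int_shift(2)[OF space_C_imp_space_L1[OF space_C_cos[of m c]], of "pi / of_int m"]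
  have "period_int (\<lambda>t. cos (of_int m * t + c)) = - 1 * period_int (\<lambda>t. cos (of_int m * t + c))"
    by (simp only: period_int_cmult)
  thus ?thesis by simp
qed

text \<open>With \<open>\<gamma> = 0\<close> this is the \<open>k\<close>-th term of the Fourier series of \<open>\<phi>\<close> (for \<open>k = 0\<close>,
twice the term); with \<open>\<gamma> = \<beta>\<pi>/2\<close> it is that term with its phase turned by \<open>\<gamma>\<close>, as in the
kernel. So \<open>\<psi>(k)\<close> times the latter is the \<open>k\<close>-th Fourier term of the function with
\<open>(\<psi>,\<beta>)\<close>-derivative \<open>\<phi>\<close>.\<close>

definition harmonic :: "real \<Rightarrow> (real \<Rightarrow> real) \<Rightarrow> nat \<Rightarrow> real \<Rightarrow> real" where
  "harmonic \<gamma> \<phi> k x = 1 / pi * period_int (\<lambda>t. cos (real k * (x - t) - \<gamma>) * \<phi> t)"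

lemma harmonic_add: "f \<in> space_L1 \<Longrightarrow> g \<in> space_L1 \<Longrightarrow>
    harmonic \<gamma> (\<lambda>t. f t + g t) k x = harmonic \<gamma> f k x + harmonic \<gamma> g k x"
  and harmonic_diff: "f \<in> space_L1 \<Longrightarrow> g \<in> space_L1 \<Longrightarrow>
    harmonic \<gamma> (\<lambda>t. f t - g t) k x = harmonic \<gamma> f k x - harmonic \<gamma> g k x"
  unfolding harmonic_def distrib_left right_diff_distrib[where a = "cos _"]
  by (simp_all only: period_int_add period_int_diff space_L1_mult_space_C space_C_kernel
      distrib_left right_diff_distrib[where a = "1 / pi"])

lemma harmonic_cmult: "harmonic \<gamma> (\<lambda>t. c * f t) k x = c * harmonic \<gamma> f k x"
  using period_int_cmult[of c "\<lambda>t. cos (real k * (x - t) - \<gamma>) * f t"]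
  by (simp add: harmonic_def mult.left_commute)

lemma harmonic_bound:
  assumes "\<phi> \<in> space_L1" shows "\<bar>harmonic \<gamma> \<phi> k x\<bar> \<le> norm_L1 \<phi> / pi"
proof -
  let ?g = "\<lambda>t. cos (real k * (x - t) - \<gamma>) * \<phi> t"
  have g: "?g \<in> space_L1" by (rule space_L1_mult_space_C[OF assms space_C_kernel])
  have "\<bar>period_int ?g\<bar> \<le> period_int (\<lambda>t. \<bar>?g t\<bar>)"
    using period_int_abs_bound[OF g] norm_L1_eq_period_int[OF g] by simp
  also have "\<dots> \<le> norm_L1 \<phi>"
    unfolding norm_L1_eq_period_int[OF assms]
    by (intro period_int_mono space_L1_abs g assms) (simp add: abs_mult mult_left_le_one_le)
  finally show ?thesis by (simp add: harmonic_def abs_mult divide_right_mono)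
qed

lemma harmonic_eq_cos:
  assumes "\<phi> \<in> space_L1"
  obtains A B where "\<And>x. harmonic \<gamma> \<phi> k x
    = A * cos (real k * x + (- \<gamma>)) + B * cos (real k * x + (- \<gamma> - pi / 2))"
proof
  fix x
  have cos_sub_half_pi: "cos (y - pi / 2) = sin y" for y :: real by (simp add: cos_diff)
  let ?c = "\<lambda>t. cos (real k * t + 0)" and ?s = "\<lambda>t. cos (real k * t + (- pi / 2))"
  have "cos (real k * (x - t) - \<gamma>) * \<phi> t
      = cos (real k * x - \<gamma>) * (?c t * \<phi> t) + sin (real k * x - \<gamma>) * (?s t * \<phi> t)" for t
    using cos_diff[of "real k * x - \<gamma>" "real k * t"]
    by (simp add: cos_add cos_sub_half_pi algebra_simps)
  moreover have "sin (real k * x - \<gamma>) = cos (real k * x + (- \<gamma> - pi / 2))"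
    by (simp add: cos_diff add_diff_eq)
  moreover have "period_int (\<lambda>t. a * (?c t * \<phi> t) + b * (?s t * \<phi> t))
      = a * period_int (\<lambda>t. ?c t * \<phi> t) + b * period_int (\<lambda>t. ?s t * \<phi> t)" for a b
    by (subst period_int_add)
       (intro space_L1_cmult space_L1_mult_space_C[OF assms space_C_cos_nat] | simp only: period_int_cmult)+
  ultimately show "harmonic \<gamma> \<phi> k x
    = (period_int (\<lambda>t. ?c t * \<phi> t) / pi) * cos (real k * x + (- \<gamma>))
      + (period_int (\<lambda>t. ?s t * \<phi> t) / pi) * cos (real k * x + (- \<gamma> - pi / 2))"
    unfolding harmonic_def by (simp only: divide_inverse) (simp add: algebra_simps)
qed

lemma harmonic_cos:
  assumes "k \<noteq> m \<or> m \<noteq> 0"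
  shows "harmonic \<gamma> (\<lambda>t. cos (real m * t + c)) k x = (if k = m then cos (real m * x + c - \<gamma>) else 0)"
proof -
  let ?p = "\<lambda>t. cos (of_int (int m - int k) * t + (real k * x - \<gamma> + c))"
  let ?q = "\<lambda>t. cos (of_int (- int k - int m) * t + (real k * x - \<gamma> - c))"
  have L1: "?p \<in> space_L1" "?q \<in> space_L1"
    by (intro space_C_imp_space_L1 space_C_cos)+
  have "cos (real k * (x - t) - \<gamma>) * cos (real m * t + c) = 1 / 2 * (?p t + ?q t)" for t
    using cos_times_cos[of "real k * (x - t) - \<gamma>" "real m * t + c"] by (simp add: algebra_simps)
  hence "harmonic \<gamma> (\<lambda>t. cos (real m * t + c)) k x
      = 1 / (2 * pi) * (period_int ?p + period_int ?q)"
    using period_int_cmult[of "1 / 2" "\<lambda>t. ?p t + ?q t"] period_int_add[OF L1]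
    by (simp only: harmonic_def) simp
  moreover have "period_int ?q = 0"
    using assms by (intro period_int_cos) auto
  moreover have "period_int ?p = (if k = m then 2 * pi * cos (real m * x + c - \<gamma>) else 0)"
  proof (cases "k = m")
    case True thus ?thesis by (simp add: period_int_const algebra_simps)
  next
    case False
    hence "period_int ?p = 0" by (intro period_int_cos) auto
    with False show ?thesis by simp
  qed
  ultimately show ?thesis by simp
qed

text \<open>Writing the sine as a cosine with a phase makes a trigonometric polynomial a combination of
functions \<open>cos (k t + c)\<close>, so that only these need testing. The weight \<open>w\<close> is merely
measurable and bounded, to cover a sign function as well as a harmonic of the kernel.\<close>

lemma trig_polys_space_C: "p \<in> trig_polys m \<Longrightarrow> p \<in> space_C"
  and orthogonal_trig_polys: "p \<in> trig_polys m \<Longrightarrow> w \<in> borel_measurable borel \<Longrightarrow> periodic_2pi w \<Longrightarrow>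
    (\<And>t. \<bar>w t\<bar> \<le> B) \<Longrightarrow> (\<And>k c. k \<le> m \<Longrightarrow> period_int (\<lambda>t. w t * cos (real k * t + c)) = 0) \<Longrightarrow>
    period_int (\<lambda>t. w t * p t) = 0"
proof -
  define q where "q a b j x = a 0 / 2 + (\<Sum>k=1..j. a k * cos (real k * x) + b k * sin (real k * x))"
    for a b :: "nat \<Rightarrow> real" and j x
  let ?r = "\<lambda>a b j x. a * cos (real j * x + 0) + b * cos (real j * x + (- pi / 2))"
  have sin: "cos (y - pi / 2) = sin y" for y :: real by (simp add: cos_diff)
  have q0: "q a b 0 = (\<lambda>x. a 0 / 2 * cos (real 0 * x + 0))" for a b by (auto simp: q_def)
  have qS: "q a b (Suc j) = (\<lambda>x. q a b j x + ?r (a (Suc j)) (b (Suc j)) (Suc j) x)" for a b j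
    unfolding q_def by (rule ext) (simp add: sin del: of_nat_Suc)
  have rC: "?r a b j \<in> space_C" for a b j
    by (intro space_C_add space_C_cmult space_C_cos_nat)
  have qC: "q a b j \<in> space_C" for a b j
  proof (induction j)
    case 0 show ?case unfolding q0 by (intro space_C_cmult space_C_cos_nat)
  next
    case (Suc j) show ?case unfolding qS by (intro space_C_add[OF Suc rC])
  qed
  have elim: "\<exists>a b. p = q a b m" if "p \<in> trig_polys m"
    using that unfolding trig_polys_def q_def by auto
  show "p \<in> space_C" if "p \<in> trig_polys m"
    using elim[OF that] qC by auto
  assume p: "p \<in> trig_polys m" and w: "w \<in> borel_measurable borel" "periodic_2pi w" "\<And>t. \<bar>w t\<bar> \<le> B"
    and orth: "\<And>k c. k \<le> m \<Longrightarrow> period_int (\<lambda>t. w t * cos (real k * t + c)) = 0"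
  have wC: "(\<lambda>t. w t * f t) \<in> space_L1" if "f \<in> space_C" for f
    by (rule space_L1_bounded_mult[OF space_C_imp_space_L1[OF that] w])
  have orth': "period_int (\<lambda>t. w t * (a * cos (real k * t + c))) = 0" if "k \<le> m" for k c a
    using period_int_cmult[of a "\<lambda>t. w t * cos (real k * t + c)"] orth[OF that]
    by (simp add: mult.left_commute)
  have r: "period_int (\<lambda>t. w t * ?r a b k t) = 0" if "k \<le> m" for a b k
    using orth'[OF that, of a 0] orth'[OF that, of b "- pi / 2"]
      period_int_add[OF wC wC, OF space_C_cmult space_C_cmult, OF space_C_cos_nat space_C_cos_nat, of a k 0 b k "- pi / 2"]
    by (simp only: ring_distribs)
  have "j \<le> m \<Longrightarrow> period_int (\<lambda>t. w t * q a b j t) = 0" for a b j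
  proof (induction j)
    case 0 show ?case unfolding q0 by (rule orth') simp
  next
    case (Suc j)
    have "period_int (\<lambda>t. w t * q a b (Suc j) t)
        = period_int (\<lambda>t. w t * q a b j t + w t * ?r (a (Suc j)) (b (Suc j)) (Suc j) t)"
      unfolding qS by (simp only: ring_distribs)
    also have "\<dots> = 0"
      unfolding period_int_add[OF wC[OF qC] wC[OF rC]] r[OF Suc.prems]
      using Suc by simp
    finally show ?case .
  qed
  thus "period_int (\<lambda>t. w t * p t) = 0" using elim[OF p] by auto
qed

lemma harmonic_trig_poly:
  assumes "p \<in> trig_polys m" and "m < k"
  shows "harmonic \<gamma> p k x = 0"
proof -
  have "period_int (\<lambda>t. cos (real k * (x - t) - \<gamma>) * p t) = 0"
  proof (rule orthogonal_trig_polys[OF assms(1), where B = 1])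
    show "period_int (\<lambda>t. cos (real k * (x - t) - \<gamma>) * cos (real j * t + c)) = 0" if "j \<le> m" for j c
      using that assms(2) harmonic_cos[of k j \<gamma> c x] by (simp add: harmonic_def)
  qed (use space_C_kernel[of k x \<gamma>] in
      \<open>auto simp: space_C_def intro: borel_measurable_continuous_onI\<close>)
  thus ?thesis by (simp add: harmonic_def)
qed

lemma fourier_sum_eq_harmonic:
  assumes "f \<in> space_L1"
  shows "fourier_sum m f x = harmonic 0 f 0 x / 2 + (\<Sum>k=1..m. harmonic 0 f k x)"
proof -
  have *: "harmonic 0 f k x = fourier_cos f k * cos (real k * x) + fourier_sin f k * sin (real k * x)" for k
  proof -
    let ?c = "\<lambda>t. cos (real k * t) * f t" and ?s = "\<lambda>t. sin (real k * t) * f t"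
    have "(\<lambda>t. cos (real k * t + 0) * f t) \<in> space_L1" "(\<lambda>t. cos (real k * t + (- pi / 2)) * f t) \<in> space_L1"
      by (intro space_L1_mult_space_C[OF assms] space_C_cos_nat)+
    hence L1: "?c \<in> space_L1" "?s \<in> space_L1" by (simp_all add: cos_diff)
    have "cos (real k * (x - t) - 0) * f t = cos (real k * x) * ?c t + sin (real k * x) * ?s t" for t
      by (simp add: right_diff_distrib cos_diff algebra_simps)
    thus ?thesis
      using period_int_add[OF space_L1_cmult[OF L1(1)] space_L1_cmult[OF L1(2)], of "cos (real k * x)" "sin (real k * x)"]
      unfolding harmonic_def period_int_cmult
      by (simp add: fourier_cos_def fourier_sin_def period_int_def mult.commute ring_distribs)
  qed
  show ?thesis unfolding fourier_sum_def * by simp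
qed

section \<open>The remainder of the Fourier sum\<close>

text \<open>A series of harmonics dominated by a summable sequence is the Fourier series of its sum, hence
the remainder of the Fourier sum is the tail of the series.\<close>

lemma fourier_sum_remainder:
  assumes f: "\<And>x. f x = a / 2 + (\<Sum>k. u (Suc k) x)"
    and u: "\<And>k. u (Suc k) = (\<lambda>x. A k * cos (real (Suc k) * x + c) + B k * cos (real (Suc k) * x + d))"
    and bd: "\<And>k x. \<bar>u (Suc k) x\<bar> \<le> M k" and sm: "summable M"
  shows "(\<lambda>k. u (Suc k + m) x) sums (f x - fourier_sum m f x)"
proof -
  have uC: "u (Suc k) \<in> space_C" for k
    unfolding u by (intro space_C_add space_C_cmult space_C_cos_nat)
  have fC: "(\<lambda>x. a / 2 + (\<Sum>k. u (Suc k) x)) \<in> space_C"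
    by (intro space_C_add space_C_const space_C_suminf[OF uC bd sm])
  have f': "f = (\<lambda>x. a / 2 + (\<Sum>k. u (Suc k) x))" by (auto simp: f)
  have fL: "f \<in> space_L1" using space_C_imp_space_L1[OF fC] f' by simp
  \<comment> \<open>The truncated \<open>j - 1\<close> is harmless: the value is 0 for \<open>j = 0\<close> in any case. In this form
    it is a series with a single term.\<close>
  have hu: "harmonic 0 (u (Suc k)) j x = (if k = j - 1 then (if j = 0 then 0 else u j x) else 0)" for k j
  proof -
    have "harmonic 0 (u (Suc k)) j x = A k * harmonic 0 (\<lambda>t. cos (real (Suc k) * t + c)) j x
        + B k * harmonic 0 (\<lambda>t. cos (real (Suc k) * t + d)) j x"
      unfolding u by (subst harmonic_add)
        (auto simp only: harmonic_cmult intro!: space_C_imp_space_L1 space_C_cmult space_C_cos_nat)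
    also have "\<dots> = (if j = Suc k then u (Suc k) x else 0)"
      by (simp add: harmonic_cos u del: of_nat_Suc)
    finally show ?thesis by (cases j) auto
  qed
  have hf: "harmonic 0 f j x = (if j = 0 then a else u j x)" for j
  proof -
    have "(\<lambda>k. period_int (\<lambda>t. u (Suc k) t * cos (real j * (x - t) - 0)))
        sums period_int (\<lambda>t. (\<Sum>k. u (Suc k) t) * cos (real j * (x - t) - 0))"
      by (rule period_int_suminf[OF space_C_imp_space_L1[OF space_C_kernel] uC bd sm])
    from sums_mult[OF this, of "1 / pi"]
    have "(\<lambda>k. harmonic 0 (u (Suc k)) j x) sums harmonic 0 (\<lambda>t. \<Sum>k. u (Suc k) t) j x"
      by (simp add: harmonic_def mult.commute)
    moreover have "(\<lambda>k. harmonic 0 (u (Suc k)) j x) sums (if j = 0 then 0 else u j x)"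
      unfolding hu by (rule sums_single)
    ultimately have "harmonic 0 (\<lambda>t. \<Sum>k. u (Suc k) t) j x = (if j = 0 then 0 else u j x)"
      by (rule sums_unique2)
    moreover have "harmonic 0 (\<lambda>t. a / 2) j x = (if j = 0 then a else 0)"
    proof (cases "j = 0")
      case True thus ?thesis by (simp add: harmonic_def period_int_const)
    next
      case False
      thus ?thesis using harmonic_cos[of j 0 0 0 x] harmonic_cmult[of 0 "a / 2" "\<lambda>t. 1" j x] by simp
    qed
    moreover have "harmonic 0 f j x = harmonic 0 (\<lambda>t. a / 2) j x + harmonic 0 (\<lambda>t. \<Sum>k. u (Suc k) t) j x"
      unfolding f' by (intro harmonic_add space_C_imp_space_L1 space_C_const space_C_suminf[OF uC bd sm])
    ultimately show ?thesis by simp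
  qed
  have "fourier_sum m f x = a / 2 + (\<Sum>k<m. u (Suc k) x)"
    unfolding fourier_sum_eq_harmonic[OF fL] hf
    by (simp add: sum.atLeast1_atMost_eq)
  moreover have "summable (\<lambda>k. u (Suc k) x)"
    using bd by (intro summable_comparison_test'[OF sm, of 0]) simp
  hence "(\<lambda>k. u (Suc (k + m)) x) sums ((\<Sum>k. u (Suc k) x) - (\<Sum>k<m. u (Suc k) x))"
    by (intro sums_split_initial_segment summable_sums)
  ultimately show "(\<lambda>k. u (Suc k + m) x) sums (f x - fourier_sum m f x)"
    by (simp add: f)
qed

lemma zero_in_trig_polys: "(\<lambda>x. 0) \<in> trig_polys m"
  by (auto simp: trig_polys_def intro!: exI[of _ "\<lambda>_. 0"])

lemma best_approx_L1_nonneg: "0 \<le> best_approx_L1 n g"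
  and le_best_approx_L1: "(\<And>p. p \<in> trig_polys (n - 1) \<Longrightarrow> c \<le> norm_L1 (\<lambda>t. g t - p t)) \<Longrightarrow> c \<le> best_approx_L1 n g"
  and best_approx_L1_le: "p \<in> trig_polys (n - 1) \<Longrightarrow> best_approx_L1 n g \<le> norm_L1 (\<lambda>t. g t - p t)"
proof -
  have nonneg: "0 \<le> norm_L1 h" for h :: "real \<Rightarrow> real"
    unfolding norm_L1_def set_lebesgue_integral_def by (rule integral_nonneg_AE) auto
  have ne: "trig_polys (n - 1) \<noteq> {}" using zero_in_trig_polys by blast
  show lower: "c \<le> best_approx_L1 n g" if "\<And>p. p \<in> trig_polys (n - 1) \<Longrightarrow> c \<le> norm_L1 (\<lambda>t. g t - p t)" for c g
    unfolding best_approx_L1_def by (rule cINF_greatest[OF ne that])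
  show "0 \<le> best_approx_L1 n g" by (rule lower[OF nonneg])
  show "best_approx_L1 n g \<le> norm_L1 (\<lambda>t. g t - p t)" if "p \<in> trig_polys (n - 1)" for p
    unfolding best_approx_L1_def by (rule cINF_lower[OF bdd_belowI2[OF nonneg] that])
qed

lemma remainder_expansion:
  assumes \<psi>: "\<And>k. k \<ge> 1 \<Longrightarrow> \<psi> k \<ge> 0" "summable \<psi>"
    and d: "is_psi_beta_deriv \<psi> \<beta> f \<phi>" and n: "n \<ge> 1"
  shows "(\<lambda>k. \<psi> (k + n) * harmonic (\<beta> * pi / 2) \<phi> (k + n) x) sums (f x - fourier_sum (n - 1) f x)"
proof -
  let ?\<gamma> = "\<beta> * pi / 2"
  let ?u = "\<lambda>k x. \<psi> k * harmonic ?\<gamma> \<phi> k x"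
  have \<phi>: "\<phi> \<in> space_L1" using d by (simp add: is_psi_beta_deriv_def)
  have sm: "summable (\<lambda>k. \<psi> (Suc k))" using \<psi>(2) by (simp add: summable_Suc_iff)
  obtain a where a: "\<And>x. f x = a / 2 + 1 / pi * period_int (\<lambda>t. Psi_kernel \<psi> \<beta> (x - t) * \<phi> t)"
    using d unfolding is_psi_beta_deriv_def period_int_def by auto
  have f: "f x = a / 2 + (\<Sum>k. ?u (Suc k) x)" for x
  proof -
    have "(\<lambda>k. period_int (\<lambda>t. \<psi> (Suc k) * cos (real (Suc k) * (x - t) - ?\<gamma>) * \<phi> t))
        sums period_int (\<lambda>t. (\<Sum>k. \<psi> (Suc k) * cos (real (Suc k) * (x - t) - ?\<gamma>)) * \<phi> t)"
      by (rule period_int_suminf[OF \<phi> space_C_cmult[OF space_C_kernel] _ sm])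
         (simp add: abs_mult \<psi>(1) mult_left_le)
    from sums_mult[OF this, of "1 / pi"]
    have "(\<lambda>k. ?u (Suc k) x) sums (1 / pi * period_int (\<lambda>t. Psi_kernel \<psi> \<beta> (x - t) * \<phi> t))"
      unfolding Psi_kernel_def mult.assoc period_int_cmult harmonic_def
      by (simp only: mult.left_commute)
    thus ?thesis using a by (simp add: sums_unique)
  qed
  have "\<exists>A B. \<forall>x. harmonic ?\<gamma> \<phi> (Suc k) x
      = A * cos (real (Suc k) * x + (- ?\<gamma>)) + B * cos (real (Suc k) * x + (- ?\<gamma> - pi / 2))" for k
    using harmonic_eq_cos[OF \<phi>, of ?\<gamma> "Suc k"] by metis
  then obtain A B where AB: "\<And>k x. harmonic ?\<gamma> \<phi> (Suc k) x
      = A k * cos (real (Suc k) * x + (- ?\<gamma>)) + B k * cos (real (Suc k) * x + (- ?\<gamma> - pi / 2))"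
    by metis
  have "(\<lambda>k. ?u (Suc k + (n - 1)) x) sums (f x - fourier_sum (n - 1) f x)"
  proof (rule fourier_sum_remainder[where u = ?u])
    show "?u (Suc k) = (\<lambda>x. (\<psi> (Suc k) * A k) * cos (real (Suc k) * x + (- ?\<gamma>))
        + (\<psi> (Suc k) * B k) * cos (real (Suc k) * x + (- ?\<gamma> - pi / 2)))" for k
      unfolding AB by (simp only: distrib_left mult.assoc)
    show "\<bar>?u (Suc k) x\<bar> \<le> \<psi> (Suc k) * (norm_L1 \<phi> / pi)" for k x
      using harmonic_bound[OF \<phi>, of ?\<gamma> "Suc k" x] \<psi>(1)[of "Suc k"]
      by (simp only: abs_mult abs_of_nonneg mult_left_mono)
    show "summable (\<lambda>k. \<psi> (Suc k) * (norm_L1 \<phi> / pi))" by (rule summable_mult2[OF sm])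
  qed (rule f)
  moreover have "Suc k + (n - 1) = k + n" for k using n by simp
  ultimately show ?thesis by simp
qed

text \<open>Harmonics of order \<open>n\<close> and higher do not see a polynomial of order \<open>n - 1\<close>. Hence in the tail
the derivative \<open>\<phi>\<close> may be replaced by \<open>\<phi> - p\<close> for any such \<open>p\<close>, every term is at most
\<open>\<psi>(k) \<parallel>\<phi> - p\<parallel>\<^sub>1 / \<pi>\<close>, and \<open>p\<close> is free.\<close>

lemma remainder_le:
  assumes \<psi>: "\<And>k. k \<ge> 1 \<Longrightarrow> \<psi> k \<ge> 0" "summable \<psi>"
    and d: "is_psi_beta_deriv \<psi> \<beta> f \<phi>" and n: "n \<ge> 1"
  shows "\<bar>f x - fourier_sum (n - 1) f x\<bar> \<le> 1 / pi * (\<Sum>k. \<psi> (k + n)) * best_approx_L1 n \<phi>"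
proof -
  let ?S = "\<Sum>k. \<psi> (k + n)" and ?R = "f x - fourier_sum (n - 1) f x"
  let ?H = "harmonic (\<beta> * pi / 2)"
  have \<phi>: "\<phi> \<in> space_L1" using d by (simp add: is_psi_beta_deriv_def)
  have sm: "summable (\<lambda>k. \<psi> (k + n))" using \<psi>(2) by (rule summable_ignore_initial_segment)
  have nn: "\<psi> (k + n) \<ge> 0" for k using \<psi>(1) n by simp
  have S0: "0 \<le> ?S" by (rule suminf_nonneg[OF sm nn])
  have le: "\<bar>?R\<bar> \<le> ?S * (norm_L1 (\<lambda>t. \<phi> t - p t) / pi)" if p: "p \<in> trig_polys (n - 1)" for p
  proof -
    have pL: "p \<in> space_L1" by (intro space_C_imp_space_L1 trig_polys_space_C[OF p])
    have "?H \<phi> (k + n) x = ?H (\<lambda>t. \<phi> t - p t) (k + n) x" for k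
      using harmonic_diff[OF \<phi> pL] harmonic_trig_poly[OF p, of "k + n"] n by simp
    hence bd: "\<bar>\<psi> (k + n) * ?H \<phi> (k + n) x\<bar> \<le> \<psi> (k + n) * (norm_L1 (\<lambda>t. \<phi> t - p t) / pi)" for k
      using harmonic_bound[OF space_L1_diff[OF \<phi> pL]] nn
      by (simp only: abs_mult abs_of_nonneg mult_left_mono)
    have sums: "(\<lambda>k. \<psi> (k + n) * (norm_L1 (\<lambda>t. \<phi> t - p t) / pi)) sums (?S * (norm_L1 (\<lambda>t. \<phi> t - p t) / pi))"
      by (rule sums_mult2[OF summable_sums[OF sm]])
    have "?R \<le> ?S * (norm_L1 (\<lambda>t. \<phi> t - p t) / pi)"
      by (rule sums_le[OF _ remainder_expansion[OF \<psi> d n, of x] sums]) (use bd in \<open>auto simp: abs_le_iff\<close>)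
    moreover have "- ?R \<le> ?S * (norm_L1 (\<lambda>t. \<phi> t - p t) / pi)"
      by (rule sums_le[OF _ sums_minus[OF remainder_expansion[OF \<psi> d n, of x]] sums])
         (use bd in \<open>auto simp: abs_le_iff\<close>)
    ultimately show ?thesis by simp
  qed
  show ?thesis
  proof (cases "?S = 0")
    case True
    from le[OF zero_in_trig_polys] True show ?thesis by simp
  next
    case False
    hence S: "0 < ?S" using S0 by simp
    have "pi * \<bar>?R\<bar> / ?S \<le> best_approx_L1 n \<phi>"
      by (rule le_best_approx_L1) (use le S in \<open>auto simp: field_simps\<close>)
    thus ?thesis using S by (simp add: field_simps)
  qed
qed

text \<open>By the pointwise bound the supremum in \<^const>\<open>norm_C\<close> is over a bounded set, so that it also
dominates the single values.\<close>

lemma norm_C_remainder: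
  assumes \<psi>: "\<And>k. k \<ge> 1 \<Longrightarrow> \<psi> k \<ge> 0" "summable \<psi>"
    and d: "is_psi_beta_deriv \<psi> \<beta> f \<phi>" and n: "n \<ge> 1"
  shows "norm_C (\<lambda>x. f x - fourier_sum (n - 1) f x) \<le> 1 / pi * (\<Sum>k. \<psi> (k + n)) * best_approx_L1 n \<phi>"
    and "\<bar>f x - fourier_sum (n - 1) f x\<bar> \<le> norm_C (\<lambda>x. f x - fourier_sum (n - 1) f x)"
  unfolding norm_C_def using remainder_le[OF \<psi> d n]
  by (auto intro!: cSUP_least cSUP_upper2 bdd_aboveI2)

lemma psi_beta_convolution:
  assumes \<Phi>: "\<Phi> \<in> space_L1" "period_int \<Phi> = 0"
    and F: "F = (\<lambda>x. 1 / pi * period_int (\<lambda>t. Psi_kernel \<psi> \<beta> (x - t) * \<Phi> t))"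
  shows "is_psi_beta_deriv \<psi> \<beta> F \<Phi>" and "F \<in> class_C_psi_beta_L1 \<psi> \<beta>"
proof -
  show d: "is_psi_beta_deriv \<psi> \<beta> F \<Phi>"
    unfolding is_psi_beta_deriv_def F period_int_def[symmetric]
    using \<Phi> by (auto simp: exI[of _ "0::real"] simp del: times_divide_eq_left)
  have "cos (real k * (x + 2 * pi - t) - c) = cos (real k * (x - t) - c)" for k x t c
    using cos.plus_of_nat[of "real k * (x - t) - c" k]
    by (simp add: algebra_simps)
  hence "Psi_kernel \<psi> \<beta> (x + 2 * pi - t) = Psi_kernel \<psi> \<beta> (x - t)" for x t
    unfolding Psi_kernel_def by (simp del: of_nat_Suc)
  hence "periodic_2pi F" by (simp add: periodic_2pi_def F)
  with d show "F \<in> class_C_psi_beta_L1 \<psi> \<beta>" by (auto simp: class_C_psi_beta_L1_def)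
qed

section \<open>Extremal derivatives\<close>

text \<open>Let \<open>L c\<close> be the integral and \<open>a = k\<pi>/n\<close>. A shift by \<open>\<pi>/n\<close> gives \<open>L (c + a) = - L c\<close>, while
\<open>L (c + a) + L (c - a) = 2 cos a * L c\<close> by the addition theorem. Together
\<open>(1 + cos a) * L c = 0\<close>, and \<open>0 \<le> a < \<pi>\<close> excludes \<open>cos a = -1\<close>.\<close>

lemma antiperiodic_orthogonal:
  assumes h: "h \<in> borel_measurable borel" "periodic_2pi h" "\<And>t. \<bar>h t\<bar> \<le> B"
    and anti: "\<And>t. h (t + pi / real n) = - h t" and "k < n"
  shows "period_int (\<lambda>t. h t * cos (real k * t + c)) = 0"
proof -
  define a where "a = real k * pi / real n"
  define L where "L c = period_int (\<lambda>t. h t * cos (real k * t + c))" for c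
  have L1: "(\<lambda>t. h t * cos (real k * t + c)) \<in> space_L1" for c
    by (rule space_L1_bounded_mult[OF space_C_imp_space_L1[OF space_C_cos_nat] h])
  have shift: "L (c + a) = - L c" for c
  proof -
    have "h (t + pi / real n) * cos (real k * (t + pi / real n) + c)
        = - 1 * (h t * cos (real k * t + (c + a)))" for t
      by (simp add: anti a_def algebra_simps)
    with period_int_shift(2)[OF L1[of c], of "pi / real n"]
    have "L c = period_int (\<lambda>t. - 1 * (h t * cos (real k * t + (c + a))))"
      by (simp only: L_def)
    thus ?thesis unfolding period_int_cmult by (simp add: L_def)
  qed
  have "h t * cos (real k * t + (c + a)) + h t * cos (real k * t + (c - a))
      = 2 * cos a * (h t * cos (real k * t + c))" for t
    using cos_add[of "real k * t + c" a] cos_diff[of "real k * t + c" a]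
    by (simp add: add.assoc add_diff_eq distrib_left[symmetric])
  hence "L (c + a) + L (c - a) = 2 * cos a * L c"
    unfolding L_def period_int_add[OF L1 L1, symmetric] period_int_cmult[symmetric] by simp
  moreover have "L (c - a) = - L c" using shift[of "c - a"] by simp
  ultimately have "(1 + cos a) * L c = 0" using shift[of c] by (simp add: algebra_simps)
  moreover have "cos pi < cos a"
    using assms(5) by (intro cos_monotone_0_pi) (auto simp: a_def field_simps)
  ultimately show ?thesis by (simp add: L_def)
qed

lemma cos_ge_one_minus_abs: "1 - \<bar>z\<bar> \<le> cos z" for z :: real
proof -
  have "cos z = 1 - 2 * (sin (z / 2))\<^sup>2"
    using cos_double_sin[of "z / 2"] by simp
  moreover have "(sin (z / 2))\<^sup>2 \<le> \<bar>sin (z / 2)\<bar>"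
    using mult_left_le[of "\<bar>sin (z / 2)\<bar>" "\<bar>sin (z / 2)\<bar>"] by (simp add: power2_eq_square abs_mult_self_eq)
  moreover have "\<bar>sin (z / 2)\<bar> \<le> \<bar>z / 2\<bar>" by (rule abs_sin_x_le_abs_x)
  ultimately show ?thesis by simp
qed

text \<open>A continuous substitute for a point mass at 0, periodic by construction and supported in the
\<open>\<delta>\<close>-neighbourhood of \<open>2\<pi>\<int>\<close>.\<close>

definition bump :: "real \<Rightarrow> real \<Rightarrow> real" where
  "bump \<delta> u = max 0 (cos u - cos \<delta>)"

lemma bump_nonneg: "0 \<le> bump \<delta> u"
  by (simp add: bump_def)

lemma bump_space_C: "bump \<delta> \<in> space_C"
  unfolding bump_def space_C_def periodic_2pi_def by (auto intro!: continuous_intros)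

lemma bump_support:
  assumes "bump \<delta> u \<noteq> 0" and "0 < \<delta>" "\<delta> \<le> pi"
  obtains l :: int and v where "u = v + of_int l * (2 * pi)" and "\<bar>v\<bar> < \<delta>"
proof -
  define l where "l = \<lfloor>(u + pi) / (2 * pi)\<rfloor>"
  define v where "v = u - of_int l * (2 * pi)"
  have "of_int l * (2 * pi) \<le> u + pi" "u + pi < (of_int l + 1) * (2 * pi)"
    unfolding l_def using floor_correct[of "(u + pi) / (2 * pi)"]
    by (simp_all add: pos_le_divide_eq[symmetric] pos_divide_less_eq[symmetric] del: add_divide_distrib)
  hence v: "\<bar>v\<bar> \<le> pi" by (auto simp: v_def algebra_simps)
  have u: "u = v + of_int l * (2 * pi)" by (simp add: v_def)
  have "cos \<delta> < cos \<bar>v\<bar>"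
    using assms(1) cos.plus_of_int[of v l] unfolding u bump_def by (auto simp: max_def split: if_splits)
  hence "\<bar>v\<bar> < \<delta>"
    using v assms cos_mono_less_eq[of \<delta> "\<bar>v\<bar>"] by auto
  with u that show ?thesis by blast
qed

lemma period_int_bump_pos:
  assumes "0 < \<delta>" "\<delta> \<le> pi" shows "0 < period_int (bump \<delta>)"
proof (rule ccontr)
  have L: "bump \<delta> \<in> space_L1" by (rule space_C_imp_space_L1[OF bump_space_C])
  assume "\<not> 0 < period_int (bump \<delta>)"
  moreover have "0 \<le> period_int (bump \<delta>)"
    using period_int_mono[OF space_C_imp_space_L1[OF space_C_const] L, of 0] bump_nonneg
    by (simp add: period_int_const)
  ultimately have "integral {0..2 * pi} (bump \<delta>) = 0"
    using period_int_eq[OF L] by simp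
  moreover have "continuous_on {0..2 * pi} (bump \<delta>)"
    using bump_space_C by (auto simp: space_C_def intro: continuous_on_subset)
  ultimately have "bump \<delta> 0 = 0"
    using has_integral_0_cbox_imp_0[of 0 "2 * pi" "bump \<delta>" 0] bump_nonneg
      integrable_integral[OF integrable_continuous_interval[of 0 "2 * pi" "bump \<delta>"]] by (simp add: not_le)
  moreover have "cos \<delta> < cos 0" using assms by (intro cos_monotone_0_pi) auto
  ultimately show False by (simp add: bump_def)
qed

text \<open>The derivative \<open>\<Phi>\<close> consists of a positive bump at \<open>t0\<close> and a negative bump at
\<open>t1 = t0 + \<pi>/n\<close>, of equal mass.

The sign \<open>h\<close> of \<open>cos (n (t - t0))\<close> agrees with the sign of \<open>\<Phi>\<close> on both bumps and is orthogonal to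
the polynomials of order \<open>n - 1\<close>; by duality none of these approximates \<open>\<Phi>\<close> better than 0 does.

At \<open>x = 0\<close> the kernel harmonic of order \<open>k\<close> is \<open>cos (k t + \<gamma>)\<close>. For \<open>k = n\<close> the choice of \<open>t0\<close>
makes it \<open>\<plusminus>1\<close> at \<open>t0\<close> and \<open>\<minusplus>1\<close> at \<open>t1\<close>. For \<open>k > n\<close> its phase, relative to order \<open>n\<close>, is off by
\<open>(k - n) t0\<close> or \<open>(k - n) t1\<close>, and \<open>t0\<close>, \<open>t1\<close> lie within \<open>\<pi>/n\<close> of 0. The width of the bumps adds
an error of at most \<open>k \<delta>\<close>.\<close>

lemma alternating_bumps:
  assumes n: "n \<ge> 1" and \<delta>: "0 < \<delta>" "\<delta> \<le> pi / (2 * real n)" and E: "0 \<le> E"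
  obtains \<Phi> \<epsilon> where "\<Phi> \<in> space_L1" "period_int \<Phi> = 0" "best_approx_L1 n \<Phi> = E" "\<bar>\<epsilon>\<bar> = (1::real)"
    "\<forall>k\<ge>n. \<epsilon> * harmonic \<gamma> \<Phi> k 0
        \<ge> (1 - (real k - real n) * (pi / real n) - real k * \<delta>) * (E / pi)"
proof -
  \<comment> \<open>Reducing the phase modulo \<open>\<pi>\<close>, at the cost of the sign \<open>\<epsilon>\<close>, keeps both bumps
    within \<open>\<pi>/n\<close> of 0.\<close>
  define m where "m = \<lfloor>\<gamma> / pi\<rfloor>"
  define \<theta> where "\<theta> = \<gamma> - of_int m * pi"
  have "of_int m * pi \<le> \<gamma>" "\<gamma> < (of_int m + 1) * pi"
    using floor_correct[of "\<gamma> / pi"] unfolding m_def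
    by (simp_all add: pos_le_divide_eq[symmetric] pos_divide_less_eq[symmetric])
  hence \<theta>: "0 \<le> \<theta>" "\<theta> < pi" unfolding \<theta>_def by (simp_all add: algebra_simps)
  define t0 where "t0 = - \<theta> / real n"
  define t1 where "t1 = t0 + pi / real n"
  have t: "\<bar>t0\<bar> \<le> pi / real n" "\<bar>t1\<bar> \<le> pi / real n"
    using \<theta> n by (auto simp: t0_def t1_def abs_le_iff field_simps)
  have nt: "real n * t0 = - \<theta>" "real n * t1 = pi - \<theta>"
    using n by (auto simp: t0_def t1_def field_simps)
  define \<epsilon> where "\<epsilon> = cos (of_int m * pi)"
  have sin_m: "sin (of_int m * pi) = 0" using sin_zero_iff_int2 by blast
  hence \<epsilon>2: "\<epsilon> * \<epsilon> = 1" using sin_cos_squared_add[of "of_int m * pi"]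
    by (simp add: \<epsilon>_def power2_eq_square)
  have \<epsilon>1: "\<bar>\<epsilon>\<bar> = 1" using \<epsilon>2 by (auto simp: square_eq_1_iff)
  have cos_\<gamma>: "cos (y + \<gamma>) = \<epsilon> * cos (y + \<theta>)" for y
  proof -
    have eq: "y + \<gamma> = (y + \<theta>) + of_int m * pi" by (simp add: \<theta>_def)
    show ?thesis
      by (simp only: eq cos_add[of "y + \<theta>" "of_int m * pi"] sin_m) (simp add: \<epsilon>_def)
  qed
  have per: "cos (real k * (v + of_int l * (2 * pi)) + c) = cos (real k * v + c)" for k v c and l :: int
    using cos.plus_of_int[of "real k * v + c" "int k * l"] by (simp add: algebra_simps)
  have "pi / (2 * real n) \<le> pi" using n by (simp add: field_simps)
  hence \<delta>_pi: "\<delta> \<le> pi" using \<delta>(2) by simp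
  let ?g0 = "\<lambda>t. bump \<delta> (t + (- t0))" and ?g1 = "\<lambda>t. bump \<delta> (t + (- t1))"
  define h where "h t = sgn (cos (real n * t + \<theta>))" for t
  have lower: "1 - (real k - real n) * (pi / real n) - real k * \<delta> \<le> cos ((real k - real n) * s + real k * v)"
    if "\<bar>s\<bar> \<le> pi / real n" "\<bar>v\<bar> < \<delta>" "k \<ge> n" for s v k
  proof -
    have "\<bar>(real k - real n) * s + real k * v\<bar> \<le> (real k - real n) * \<bar>s\<bar> + real k * \<bar>v\<bar>"
      using that(3) by (intro order_trans[OF abs_triangle_ineq]) (simp add: abs_mult)
    also have "\<dots> \<le> (real k - real n) * (pi / real n) + real k * \<delta>"
      using that by (intro add_mono mult_left_mono) auto
    finally show ?thesis using cos_ge_one_minus_abs[of "(real k - real n) * s + real k * v"] by linarith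
  qed
  have nv: "\<bar>real n * v\<bar> < pi / 2" if "\<bar>v\<bar> < \<delta>" for v
  proof -
    have "\<bar>real n * v\<bar> < real n * \<delta>" using that n by (simp add: abs_mult)
    also have "\<dots> \<le> real n * (pi / (2 * real n))" using \<delta>(2) by (intro mult_left_mono) auto
    also have "\<dots> = pi / 2" using n by simp
    finally show ?thesis .
  qed
  have supp0: "h t = 1" "k \<ge> n \<Longrightarrow> 1 - (real k - real n) * (pi / real n) - real k * \<delta> \<le> \<epsilon> * cos (real k * t + \<gamma>)"
    if nz: "?g0 t \<noteq> 0" for t k
  proof -
    obtain l :: int and v where "t + - t0 = v + of_int l * (2 * pi)" and v: "\<bar>v\<bar> < \<delta>"
      using bump_support[OF nz \<delta>(1) \<delta>_pi] by blast
    hence t: "t = (t0 + v) + of_int l * (2 * pi)" by simp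
    have "cos (real n * t + \<theta>) = cos (real n * v)"
      unfolding t per using nt by (simp add: distrib_left)
    moreover have "0 < cos (real n * v)" using nv[OF v] by (intro cos_gt_zero_pi) auto
    ultimately show "h t = 1" by (simp add: h_def)
    have "\<epsilon> * cos (real k * t + \<gamma>) = cos (real k * t + \<theta>)"
      unfolding cos_\<gamma> using \<epsilon>2 by (simp add: mult.assoc[symmetric])
    also have "\<dots> = cos ((real k - real n) * t0 + real k * v)"
      unfolding t per using nt by (simp add: algebra_simps)
    finally show "1 - (real k - real n) * (pi / real n) - real k * \<delta> \<le> \<epsilon> * cos (real k * t + \<gamma>)" if "k \<ge> n"
      using lower[OF \<open>\<bar>t0\<bar> \<le> _\<close> v that] by simp
  qed
  have supp1: "h t = - 1" "k \<ge> n \<Longrightarrow> 1 - (real k - real n) * (pi / real n) - real k * \<delta> \<le> - \<epsilon> * cos (real k * t + \<gamma>)"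
    if nz: "?g1 t \<noteq> 0" for t k
  proof -
    obtain l :: int and v where "t + - t1 = v + of_int l * (2 * pi)" and v: "\<bar>v\<bar> < \<delta>"
      using bump_support[OF nz \<delta>(1) \<delta>_pi] by blast
    hence t: "t = (t1 + v) + of_int l * (2 * pi)" by simp
    have "cos (real n * t + \<theta>) = - cos (real n * v)"
      unfolding t per using nt by (simp add: distrib_left)
    moreover have "0 < cos (real n * v)" using nv[OF v] by (intro cos_gt_zero_pi) auto
    ultimately show "h t = - 1" by (simp add: h_def)
    have "- \<epsilon> * cos (real k * t + \<gamma>) = - cos (real k * t + \<theta>)"
      unfolding cos_\<gamma> using \<epsilon>2 by (simp add: mult.assoc[symmetric])
    also have "\<dots> = cos ((real k - real n) * t1 + real k * v)"
    proof -
      have "real k * (t1 + v) + \<theta> = ((real k - real n) * t1 + real k * v) + pi"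
        using nt by (simp add: algebra_simps)
      thus ?thesis unfolding t per by simp
    qed
    finally show "1 - (real k - real n) * (pi / real n) - real k * \<delta> \<le> - \<epsilon> * cos (real k * t + \<gamma>)" if "k \<ge> n"
      using lower[OF \<open>\<bar>t1\<bar> \<le> _\<close> v that] by simp
  qed
  have b: "bump \<delta> \<in> space_L1" by (rule space_C_imp_space_L1[OF bump_space_C])
  have g: "?g0 \<in> space_L1" "?g1 \<in> space_L1" by (intro period_int_shift(1)[OF b])+
  have I: "period_int ?g0 = period_int (bump \<delta>)" "period_int ?g1 = period_int (bump \<delta>)"
    by (intro period_int_shift(2)[OF b])+
  have pos: "0 < period_int (bump \<delta>)" by (rule period_int_bump_pos[OF \<delta>(1) \<delta>_pi])
  define c where "c = E / (2 * period_int (bump \<delta>))"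
  have c: "0 \<le> c" using E pos by (simp add: c_def)
  define \<Phi> where "\<Phi> t = c * (?g0 t - ?g1 t)" for t
  define A where "A t = c * (?g0 t + ?g1 t)" for t
  have \<Phi>: "\<Phi> \<in> space_L1" unfolding \<Phi>_def by (intro space_L1_cmult space_L1_diff g)
  have AL: "A \<in> space_L1" unfolding A_def by (intro space_L1_cmult space_L1_add g)
  have \<Phi>0: "period_int \<Phi> = 0"
    unfolding \<Phi>_def period_int_cmult period_int_diff[OF g] I by simp
  have IA: "period_int A = E"
    unfolding A_def period_int_cmult period_int_add[OF g] I using pos by (simp add: c_def)
  have h\<Phi>: "h t * \<Phi> t = A t" for t
    using supp0(1)[of t] supp1(1)[of t] unfolding \<Phi>_def A_def
    by (cases "?g0 t = 0"; cases "?g1 t = 0") auto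
  have abs\<Phi>: "\<bar>\<Phi> t\<bar> \<le> A t" for t
    using mult_nonneg_nonneg[OF c bump_nonneg[of \<delta> "t + - t0"]] mult_nonneg_nonneg[OF c bump_nonneg[of \<delta> "t + - t1"]]
    by (simp add: \<Phi>_def A_def algebra_simps abs_le_iff)
  have habs: "\<bar>h t\<bar> \<le> 1" for t by (simp add: h_def abs_sgn_eq)
  have hper: "periodic_2pi h"
    using per[of n _ 1 \<theta>] by (simp add: periodic_2pi_def h_def)
  have hborel: "h \<in> borel_measurable borel"
    unfolding h_def by measurable
  have hanti: "h (t + pi / real n) = - h t" for t
  proof -
    have eq: "real n * (t + pi / real n) + \<theta> = (real n * t + \<theta>) + pi" using n by (simp add: algebra_simps)
    show ?thesis unfolding h_def eq cos_periodic_pi sgn_minus ..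
  qed
  have dual: "E \<le> norm_L1 (\<lambda>t. \<Phi> t - p t)" if p: "p \<in> trig_polys (n - 1)" for p
  proof -
    have pL: "p \<in> space_L1" by (intro space_C_imp_space_L1 trig_polys_space_C[OF p])
    have orth: "period_int (\<lambda>t. h t * p t) = 0"
      using n by (intro orthogonal_trig_polys[OF p hborel hper habs] antiperiodic_orthogonal[OF hborel hper habs hanti]) auto
    have hpL: "(\<lambda>t. h t * p t) \<in> space_L1" by (rule space_L1_bounded_mult[OF pL hborel hper habs])
    have "E = period_int (\<lambda>t. A t - h t * p t)"
      using period_int_diff[OF AL hpL] orth IA by simp
    also have "\<dots> \<le> period_int (\<lambda>t. \<bar>\<Phi> t - p t\<bar>)"
    proof (intro period_int_mono space_L1_diff AL hpL space_L1_abs \<Phi> pL)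
      fix t
      have "A t - h t * p t = h t * (\<Phi> t - p t)" by (simp add: h\<Phi>[symmetric] right_diff_distrib)
      also have "\<dots> \<le> \<bar>h t\<bar> * \<bar>\<Phi> t - p t\<bar>" by (simp add: abs_mult[symmetric])
      also have "\<dots> \<le> \<bar>\<Phi> t - p t\<bar>" using habs by (simp add: mult_left_le_one_le)
      finally show "A t - h t * p t \<le> \<bar>\<Phi> t - p t\<bar>" .
    qed
    finally show ?thesis by (simp add: norm_L1_eq_period_int[OF space_L1_diff[OF \<Phi> pL]])
  qed
  have "norm_L1 \<Phi> \<le> E"
    unfolding norm_L1_eq_period_int[OF \<Phi>] IA[symmetric]
    by (intro period_int_mono space_L1_abs \<Phi> AL abs\<Phi>)
  hence best: "best_approx_L1 n \<Phi> = E"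
    using best_approx_L1_le[OF zero_in_trig_polys, of n \<Phi>] le_best_approx_L1[OF dual] by fastforce
  have "(1 - (real k - real n) * (pi / real n) - real k * \<delta>) * (E / pi) \<le> \<epsilon> * harmonic \<gamma> \<Phi> k 0"
    if k: "k \<ge> n" for k
  proof -
    let ?a = "1 - (real k - real n) * (pi / real n) - real k * \<delta>"
    have kL: "(\<lambda>t. cos (real k * (0 - t) - \<gamma>) * \<Phi> t) \<in> space_L1"
      by (rule space_L1_mult_space_C[OF \<Phi> space_C_kernel])
    have "?a * E = period_int (\<lambda>t. ?a * A t)" unfolding period_int_cmult IA ..
    also have "\<dots> \<le> period_int (\<lambda>t. \<epsilon> * (cos (real k * (0 - t) - \<gamma>) * \<Phi> t))"
    proof (intro period_int_mono space_L1_cmult AL kL)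
      fix t
      have cos_eq: "cos (real k * (0 - t) - \<gamma>) = cos (real k * t + \<gamma>)"
        using cos_minus[of "real k * t + \<gamma>"] by simp
      have "?a * ?g0 t \<le> \<epsilon> * cos (real k * t + \<gamma>) * ?g0 t"
      proof (cases "?g0 t = 0")
        case False
        show ?thesis
          by (rule mult_right_mono[OF supp0(2)[OF False k] bump_nonneg])
      qed simp
      moreover have "?a * ?g1 t \<le> - \<epsilon> * cos (real k * t + \<gamma>) * ?g1 t"
      proof (cases "?g1 t = 0")
        case False
        show ?thesis
          by (rule mult_right_mono[OF supp1(2)[OF False k] bump_nonneg])
      qed simp
      ultimately have "c * (?a * ?g0 t + ?a * ?g1 t)
          \<le> c * (\<epsilon> * cos (real k * t + \<gamma>) * ?g0 t + - \<epsilon> * cos (real k * t + \<gamma>) * ?g1 t)"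
        by (intro mult_left_mono add_mono c)
      thus "?a * A t \<le> \<epsilon> * (cos (real k * (0 - t) - \<gamma>) * \<Phi> t)"
        unfolding cos_eq A_def \<Phi>_def by (simp add: algebra_simps)
    qed
    also have "\<dots> = pi * (\<epsilon> * harmonic \<gamma> \<Phi> k 0)"
      unfolding period_int_cmult harmonic_def by simp
    finally show ?thesis by (simp add: field_simps)
  qed
  with that[OF \<Phi> \<Phi>0 best \<epsilon>1] show ?thesis by blast
qed

text \<open>
A prescribed loss of \<open>2 \<pi> W / n\<close> suffices: the bumps cost \<open>\<delta> M\<close> with
\<open>M = \<Sum>\<^sub>k\<^sub>\<ge>\<^sub>n k \<psi>(k)\<close>, the phases cost \<open>\<pi> W / n\<close>, and since \<open>W > 0\<close> the remaining
\<open>\<pi> W / n\<close> leaves room for bumps of positive width.\<close>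

lemma large_remainder:
  assumes \<psi>: "\<And>k. k \<ge> 1 \<Longrightarrow> \<psi> k \<ge> 0" "summable (\<lambda>k. real k * \<psi> k)" "summable \<psi>"
    and n: "n \<ge> 1" and E: "0 \<le> E"
    and S: "(\<lambda>k. \<psi> (k + n)) sums S" and W: "(\<lambda>k. real k * \<psi> (k + n)) sums W" "0 < W"
  obtains F \<Phi> where "F \<in> class_C_psi_beta_L1 \<psi> \<beta>" "is_psi_beta_deriv \<psi> \<beta> F \<Phi>" "best_approx_L1 n \<Phi> = E"
    "(S - 2 * pi * W / real n) * (E / pi) \<le> \<bar>F 0 - fourier_sum (n - 1) F 0\<bar>"
proof -
  have nn: "0 \<le> \<psi> (k + n)" for k using \<psi>(1) n by simp
  obtain M where M: "(\<lambda>k. real (k + n) * \<psi> (k + n)) sums M"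
    using summable_sums[OF summable_ignore_initial_segment[OF \<psi>(2), of n]] by blast
  have M0: "0 \<le> M" by (rule sums_le[OF _ sums_zero M]) (use nn in simp)
  \<comment> \<open>The added 1 avoids a division by 0.\<close>
  define \<delta> where "\<delta> = min (pi / (2 * real n)) (pi * W / real n / (M + 1))"
  have \<delta>: "0 < \<delta>" "\<delta> \<le> pi / (2 * real n)"
    using W(2) M0 n by (auto simp: \<delta>_def)
  have "\<delta> * M \<le> \<delta> * (M + 1)" using \<delta> by simp
  also have "\<dots> \<le> pi * W / real n"
    using M0 by (simp add: \<delta>_def pos_le_divide_eq[symmetric])
  finally have \<delta>M: "\<delta> * M \<le> pi * W / real n" .
  obtain \<Phi> \<epsilon> where \<Phi>: "\<Phi> \<in> space_L1" "period_int \<Phi> = 0" "best_approx_L1 n \<Phi> = E" "\<bar>\<epsilon>\<bar> = (1::real)"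
    and low: "\<forall>k\<ge>n. \<epsilon> * harmonic (\<beta> * pi / 2) \<Phi> k 0
      \<ge> (1 - (real k - real n) * (pi / real n) - real k * \<delta>) * (E / pi)"
    by (rule alternating_bumps[OF n \<delta> E, of "\<beta> * pi / 2"])
  define F where "F = (\<lambda>x. 1 / pi * period_int (\<lambda>t. Psi_kernel \<psi> \<beta> (x - t) * \<Phi> t))"
  note F = psi_beta_convolution[OF \<Phi>(1,2) F_def]
  let ?R = "F 0 - fourier_sum (n - 1) F 0"
  let ?b = "\<lambda>k. (\<psi> (k + n) - pi / real n * (real k * \<psi> (k + n)) - \<delta> * (real (k + n) * \<psi> (k + n))) * (E / pi)"
  have "?b k \<le> \<epsilon> * (\<psi> (k + n) * harmonic (\<beta> * pi / 2) \<Phi> (k + n) 0)" for k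
  proof -
    have "?b k = \<psi> (k + n) * ((1 - (real (k + n) - real n) * (pi / real n) - real (k + n) * \<delta>) * (E / pi))"
      by (simp add: algebra_simps)
    also have "\<dots> \<le> \<psi> (k + n) * (\<epsilon> * harmonic (\<beta> * pi / 2) \<Phi> (k + n) 0)"
      by (rule mult_left_mono[OF low[rule_format] nn]) simp
    finally show ?thesis by (simp only: mult.left_commute)
  qed
  moreover have "?b sums ((S - pi / real n * W - \<delta> * M) * (E / pi))"
    by (intro sums_mult2 sums_diff sums_mult S W(1) M)
  moreover have "(\<lambda>k. \<epsilon> * (\<psi> (k + n) * harmonic (\<beta> * pi / 2) \<Phi> (k + n) 0)) sums (\<epsilon> * ?R)"
    by (rule sums_mult[OF remainder_expansion[OF \<psi>(1,3) F(1) n]])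
  ultimately have "(S - pi / real n * W - \<delta> * M) * (E / pi) \<le> \<epsilon> * ?R"
    by (rule sums_le)
  moreover have "(S - 2 * pi * W / real n) * (E / pi) \<le> (S - pi / real n * W - \<delta> * M) * (E / pi)"
    using \<delta>M E by (intro mult_right_mono) auto
  moreover have "\<epsilon> * ?R \<le> \<bar>?R\<bar>"
    using abs_ge_self[of "\<epsilon> * ?R"] \<Phi>(4) by (simp only: abs_mult mult_1)
  ultimately have "(S - 2 * pi * W / real n) * (E / pi) \<le> \<bar>?R\<bar>" by linarith
  with F(2,1) \<Phi>(3) show ?thesis by (rule that)
qed

lemma solve_for_defect:
  fixes S W E D n :: real
  assumes "0 < W" "0 < E" "0 < n"
    and lower: "(S - 2 * pi * W / n) * (E / pi) \<le> D" and upper: "D \<le> 1 / pi * S * E"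
  obtains \<xi> where "- 2 \<le> \<xi>" "\<xi> \<le> 0" "D = (1 / pi * S + \<xi> / n * W) * E"
proof
  let ?\<xi> = "(D / E - S / pi) * (n / W)"
  show "D = (1 / pi * S + ?\<xi> / n * W) * E"
    using assms(1-3) by simp
  have "D / E \<le> S / pi" using upper assms(2) by (simp add: pos_divide_le_eq)
  thus "?\<xi> \<le> 0" using assms(1-3) by (intro mult_nonpos_nonneg) auto
  have "S / pi - 2 * W / n = (S - 2 * pi * W / n) * (E / pi) / E"
    using assms(2,3) by (simp add: field_simps)
  also have "\<dots> \<le> D / E" using lower assms(2) by (intro divide_right_mono) auto
  finally have "- 2 * W / n * (n / W) \<le> ?\<xi>"
    using assms(1-3) by (intro mult_right_mono) auto
  thus "- 2 \<le> ?\<xi>" using assms(1,3) by simp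
qed

section \<open>The two estimates\<close>

theorem mainTheorem1:
  fixes \<psi> :: "nat \<Rightarrow> real" and \<beta> :: real and n :: nat
  assumes "\<And>k. k \<ge> 1 \<Longrightarrow> \<psi> k \<ge> 0"
    and "summable (\<lambda>k. real k * \<psi> k)"
    and "n \<ge> 1"
  shows "(\<forall>f \<in> class_C_psi_beta_L1 \<psi> \<beta>. \<forall>\<phi>. is_psi_beta_deriv \<psi> \<beta> f \<phi> \<longrightarrow>
            norm_C (\<lambda>x. f x - fourier_sum (n - 1) f x)
              \<le> 1 / pi * (\<Sum>k. \<psi> (k + n)) * best_approx_L1 n \<phi>)
       \<and> ((\<psi> n > 0 \<longrightarrow> (\<exists>k>n. \<psi> k > 0)) \<longrightarrow>
          (\<forall>f \<in> class_C_psi_beta_L1 \<psi> \<beta>. \<forall>\<phi>. is_psi_beta_deriv \<psi> \<beta> f \<phi> \<longrightarrow>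
            (\<exists>F \<in> class_C_psi_beta_L1 \<psi> \<beta>. \<exists>\<Phi>. is_psi_beta_deriv \<psi> \<beta> F \<Phi> \<and>
               best_approx_L1 n \<Phi> = best_approx_L1 n \<phi> \<and>
               (\<exists>\<xi>::real. -2 \<le> \<xi> \<and> \<xi> \<le> 0 \<and>
                  norm_C (\<lambda>x. F x - fourier_sum (n - 1) F x)
                    = (1 / pi * (\<Sum>k. \<psi> (k + n))
                       + \<xi> / real n * (\<Sum>k. real (Suc k) * \<psi> (Suc k + n)))
                      * best_approx_L1 n \<phi>))))"
proof -
  have sm: "summable \<psi>"
  proof (rule summable_comparison_test'[OF assms(2), of 1])
    fix k :: nat assume "1 \<le> k"
    thus "norm (\<psi> k) \<le> real k * \<psi> k"
      using assms(1)[of k] mult_right_mono[of 1 "real k" "\<psi> k"] by simp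
  qed
  note rem = norm_C_remainder[OF assms(1) sm _ assms(3)]
  show ?thesis
  proof (intro conjI impI ballI allI)
    fix f \<phi> assume f: "f \<in> class_C_psi_beta_L1 \<psi> \<beta>" and d: "is_psi_beta_deriv \<psi> \<beta> f \<phi>"
    show "norm_C (\<lambda>x. f x - fourier_sum (n - 1) f x) \<le> 1 / pi * (\<Sum>k. \<psi> (k + n)) * best_approx_L1 n \<phi>"
      by (rule rem(1)[OF _ d])
  next
    assume tail: "\<psi> n > 0 \<longrightarrow> (\<exists>k>n. \<psi> k > 0)"
    fix f \<phi> assume f: "f \<in> class_C_psi_beta_L1 \<psi> \<beta>" and d: "is_psi_beta_deriv \<psi> \<beta> f \<phi>"
    define E S W where "E = best_approx_L1 n \<phi>" and "S = (\<Sum>k. \<psi> (k + n))"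
      and "W = (\<Sum>k. real (Suc k) * \<psi> (Suc k + n))"
    note defs = E_def[symmetric] S_def[symmetric] W_def[symmetric]
    let ?D = "\<lambda>F. norm_C (\<lambda>x. F x - fourier_sum (n - 1) F x)"
    have E0: "0 \<le> E" unfolding E_def by (rule best_approx_L1_nonneg)
    have nn: "0 \<le> \<psi> (k + n)" for k using assms(1,3) by simp
    have S: "(\<lambda>k. \<psi> (k + n)) sums S"
      unfolding S_def by (rule summable_sums[OF summable_ignore_initial_segment[OF sm]])
    have smW: "summable (\<lambda>k. real k * \<psi> (k + n))"
    proof (rule summable_comparison_test')
      show "summable (\<lambda>k. real (k + n) * \<psi> (k + n))"
        by (rule summable_ignore_initial_segment[OF assms(2)])
      show "norm (real k * \<psi> (k + n)) \<le> real (k + n) * \<psi> (k + n)" for k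
        using nn[of k] by (simp add: abs_mult mult_right_mono)
    qed
    have W: "(\<lambda>k. real k * \<psi> (k + n)) sums W"
      using summable_sums[OF smW] suminf_split_head[OF smW] unfolding W_def by simp
    show "\<exists>F \<in> class_C_psi_beta_L1 \<psi> \<beta>. \<exists>\<Phi>. is_psi_beta_deriv \<psi> \<beta> F \<Phi> \<and>
        best_approx_L1 n \<Phi> = best_approx_L1 n \<phi> \<and> (\<exists>\<xi>::real. -2 \<le> \<xi> \<and> \<xi> \<le> 0 \<and>
          ?D F = (1 / pi * (\<Sum>k. \<psi> (k + n)) + \<xi> / real n * (\<Sum>k. real (Suc k) * \<psi> (Suc k + n)))
            * best_approx_L1 n \<phi>)"
      unfolding defs
    \<comment> \<open>If \<open>S\<close> or \<open>E\<close> vanishes, so does the remainder of \<open>f\<close>. Otherwise some \<open>\<psi> k\<close> with \<open>k \<ge> n\<close> is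
        positive, by the hypothesis on \<open>\<psi> n\<close> even one with \<open>k > n\<close>, and this makes \<open>W\<close> positive.\<close>
    proof (cases "S * E = 0")
      case True
      hence "?D f \<le> 0" using rem(1)[OF _ d] unfolding defs by (simp only: mult.assoc mult_zero_right)
      moreover have "0 \<le> ?D f"
        using order_trans[OF abs_ge_zero rem(2)[OF _ d, of 0]] by simp
      ultimately have "?D f = 0" by simp
      also have "0 = (1 / pi * S + 0 / real n * W) * E" using True by simp
      finally have "-2 \<le> (0::real) \<and> (0::real) \<le> 0 \<and> ?D f = (1 / pi * S + 0 / real n * W) * E" by simp
      thus "\<exists>F \<in> class_C_psi_beta_L1 \<psi> \<beta>. \<exists>\<Phi>. is_psi_beta_deriv \<psi> \<beta> F \<Phi> \<and>
        best_approx_L1 n \<Phi> = E \<and> (\<exists>\<xi>::real. -2 \<le> \<xi> \<and> \<xi> \<le> 0 \<and>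
          ?D F = (1 / pi * S + \<xi> / real n * W) * E)"
        using f d E_def by blast
    next
      case False
      hence E: "0 < E" and "S \<noteq> 0" using E0 by auto
      obtain j where "\<psi> (j + n) \<noteq> 0"
      proof (rule ccontr)
        assume "\<not> thesis"
        hence "(\<lambda>k. \<psi> (k + n)) = (\<lambda>_. 0)" using that by blast
        with S sums_zero have "S = 0" by (metis sums_unique2)
        with \<open>S \<noteq> 0\<close> show False ..
      qed
      hence "0 < \<psi> (j + n)" using nn[of j] by simp
      then obtain k where k: "k > n" "\<psi> k > 0"
        using tail that[of "j + n"] by (cases j) auto
      have "0 < real (k - n) * \<psi> (k - n + n)" using k by simp
      hence "0 < (\<Sum>k. real k * \<psi> (k + n))"
        by (rule suminf_pos2[OF smW, rotated]) (use nn in simp)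
      hence Wpos: "0 < W" using sums_unique[OF W] by simp
      obtain F \<Phi> where F: "F \<in> class_C_psi_beta_L1 \<psi> \<beta>" "is_psi_beta_deriv \<psi> \<beta> F \<Phi>" "best_approx_L1 n \<Phi> = E"
        and low: "(S - 2 * pi * W / real n) * (E / pi) \<le> \<bar>F 0 - fourier_sum (n - 1) F 0\<bar>"
        by (rule large_remainder[OF assms(1,2) sm assms(3) E0 S W Wpos])
      have "(S - 2 * pi * W / real n) * (E / pi) \<le> ?D F"
        by (rule order_trans[OF low rem(2)[OF _ F(2)]])
      moreover have "?D F \<le> 1 / pi * S * E"
        using rem(1)[OF _ F(2)] unfolding S_def[symmetric] F(3) by simp
      moreover have "0 < real n" using assms(3) by simp
      ultimately obtain \<xi> where "- 2 \<le> \<xi>" "\<xi> \<le> 0" "?D F = (1 / pi * S + \<xi> / real n * W) * E"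
        using solve_for_defect[OF Wpos E] by blast
      with F show "\<exists>F \<in> class_C_psi_beta_L1 \<psi> \<beta>. \<exists>\<Phi>. is_psi_beta_deriv \<psi> \<beta> F \<Phi> \<and>
        best_approx_L1 n \<Phi> = E \<and> (\<exists>\<xi>::real. -2 \<le> \<xi> \<and> \<xi> \<le> 0 \<and>
          ?D F = (1 / pi * S + \<xi> / real n * W) * E)"
        by blast
    qed
  qed
qed

end
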